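(* Let $\varrho$ be an aperiodic, primitive, bijective substitution of constant length $L$ with $\varrho_0=\mathrm{id}$, such that the group $G$ generated by the columns of $\varrho$ is Abelian. Let $N$ be the least $n$ such that for every letter $a$ the word $\varrho^n(a)$ contains all legal words of length $2$. Let $v$ be a fixed point of $\varrho$. Then, for all $k\geqslant 1$, $$L^{k}\leqslant A_v\left(\frac{L^{k|G|}-1}{L^k-1}\right)\leqslant L^{k|G|+N}.$$
   Context: $\mathbb{N}=\mathbb{Z}_{\geqslant 0}$. A substitution on a finite alphabet $\mathcal{A}$ is a map $\varrho\colon\mathcal{A}\to\mathcal{A}^+$, extended to words by concatenation. It has constant length $L$ if $|\varrho(a)|=L$ for all $a$; its $i$-th column ($0\leqslant i\leqslant L-1$) is the map $\varrho_i\colon\mathcal{A}\to\mathcal{A}$ sending $a$ to the $i$-th letter of $\varrho(a)$ (indices from $0$). It is bijective if every column is a bijection. It is primitive if some power $\varrho^n$ is such that every $\varrho^n(a)$ contains all letters. A fixed point is $v\in\mathcal{A}^{\mathbb{N}}$ with $\varrho(v)=v$; $\varrho$ is aperiodic if it has no fixed point of the form $u^\infty$ with $u$ a finite word. $G$ is the subgroup of the symmetric group on $\mathcal{A}$ generated by $\varrho_0,\dots,\varrho_{L-1}$. A word is legal if it is a subword (consecutive block) of $\varrho^n(a)$ for some $n$ and some letter $a$. For $v\in\mathcal{A}^{\mathbb{N}}$ and $d\geqslant1$, $A_v(d)$ is the maximum (supremum, in $\mathbb{N}\cup\{\infty\}$) of all $m$ such that there is $j\in\mathbb{N}$ with $v_j=v_{j+dn}$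 for all $0\leqslant n\leqslant m-1$. *)

theory Defs
  imports "HOL-Library.Stream" "HOL-Library.Sublist" "HOL-Library.Extended_Nat"
    "HOL-Algebra.Bij" "HOL-Algebra.Elementary_Groups"
begin

text \<open>The alphabet is a finite type; finite words are lists and one-sided infinite words are streams.\<close>

definition substitution :: "('a::finite \<Rightarrow> 'a list) \<Rightarrow> bool" where
  "substitution \<rho> \<longleftrightarrow> (\<forall>a. \<rho> a \<noteq> [])"

definition subst_word :: "('a::finite \<Rightarrow> 'a list) \<Rightarrow> 'a list \<Rightarrow> 'a list" where
  "subst_word \<rho> w = concat (map \<rho> w)"

text \<open>For a substitution all the words \<^term>\<open>\<rho> a\<close> are nonempty, so that \<^const>\<open>flat\<close> is the infinite
  concatenation.\<close>

definition subst_stream :: "('a::finite \<Rightarrow> 'a list) \<Rightarrow> 'a stream \<Rightarrow> 'a stream" where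
  "subst_stream \<rho> v = flat (smap \<rho> v)"

definition subst_iter :: "('a::finite \<Rightarrow> 'a list) \<Rightarrow> nat \<Rightarrow> 'a \<Rightarrow> 'a list" where
  "subst_iter \<rho> n a = (subst_word \<rho> ^^ n) [a]"

definition constant_length :: "('a::finite \<Rightarrow> 'a list) \<Rightarrow> nat \<Rightarrow> bool" where
  "constant_length \<rho> L \<longleftrightarrow> (\<forall>a. length (\<rho> a) = L)"

definition column :: "('a::finite \<Rightarrow> 'a list) \<Rightarrow> nat \<Rightarrow> 'a \<Rightarrow> 'a" where
  "column \<rho> i a = \<rho> a ! i"

definition bijective_subst :: "('a::finite \<Rightarrow> 'a list) \<Rightarrow> nat \<Rightarrow> bool" where
  "bijective_subst \<rho> L \<longleftrightarrow> (\<forall>i<L. bij (column \<rho> i))"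

definition primitive_subst :: "('a::finite \<Rightarrow> 'a list) \<Rightarrow> bool" where
  "primitive_subst \<rho> \<longleftrightarrow> (\<exists>n\<ge>1. \<forall>a. set (subst_iter \<rho> n a) = UNIV)"

definition fixed_point :: "('a::finite \<Rightarrow> 'a list) \<Rightarrow> 'a stream \<Rightarrow> bool" where
  "fixed_point \<rho> v \<longleftrightarrow> subst_stream \<rho> v = v"

definition aperiodic_subst :: "('a::finite \<Rightarrow> 'a list) \<Rightarrow> bool" where
  "aperiodic_subst \<rho> \<longleftrightarrow> \<not> (\<exists>u. u \<noteq> [] \<and> fixed_point \<rho> (cycle u))"

text \<open>Since \<^const>\<open>subgroup_generated\<close> intersects the generating set with the carrier, this is generated by
  all the columns only if they are bijections.\<close>

definition column_group :: "('a::finite \<Rightarrow> 'a list) \<Rightarrow> nat \<Rightarrow> ('a \<Rightarrow> 'a) monoid" where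
  "column_group \<rho> L = subgroup_generated (BijGroup UNIV) (column \<rho> ` {..<L})"

definition legal :: "('a::finite \<Rightarrow> 'a list) \<Rightarrow> 'a list \<Rightarrow> bool" where
  "legal \<rho> w \<longleftrightarrow> (\<exists>n a. sublist w (subst_iter \<rho> n a))"

definition legal_pairs_index :: "('a::finite \<Rightarrow> 'a list) \<Rightarrow> nat" where
  "legal_pairs_index \<rho> =
    (LEAST n. \<forall>a w. legal \<rho> w \<and> length w = 2 \<longrightarrow> sublist w (subst_iter \<rho> n a))"

definition max_monochromatic :: "'a stream \<Rightarrow> nat \<Rightarrow> enat" where
  "max_monochromatic v d =
    Sup {enat m |m. \<exists>j. \<forall>n<m. v !! j = v !! (j + d * n)}"

end

theory Submission
  imports Defs "HOL-Algebra.Multiplicative_Group" "HOL-Number_Theory.Cong"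
begin

text \<open>Write v for the fixed point, M for the order of the column group, d for the difference, which has M
  digits 1 in base \<open>L^k\<close>, and put \<open>D = L^(k M)\<close>, \<open>P = L^N\<close>.  The letter of v at a position is obtained
  from \<open>v 0\<close> by applying the columns given by the base L digits of the position.

  For the lower bound, \<open>n d\<close> with \<open>n < L^k\<close> has M digits n in base \<open>L^k\<close>, so its letter is \<open>g^M (v 0)\<close>
  for a column g of \<open>\<rho>^k\<close>, and \<open>g^M = id\<close>.

  For the upper bound, suppose that v is constant on a progression of more than \<open>D P\<close> terms.  The blocks
  \<open>\<rho>^(k M) (v q)\<close> and \<open>\<rho>^(k M) (v (q + d))\<close> meet it at the same offset, so that \<open>v q = v (q + d)\<close> by
  bijectivity; hence v has period d on a window of \<open>d P\<close> letters.  Inside a block \<open>\<rho>^N a\<close> the letter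
  following the one at offset s is its image under a permutation, the step at s.  Because an Abelian
  transitive group acts freely, the period identifies the steps at s and \<open>s + d\<close> modulo P, and since d is
  prime to P all steps coincide with one permutation.  By the choice of N every legal word of length 2 occurs
  in such a block, so v is the orbit of a single permutation and therefore periodic, a contradiction.\<close>

section \<open>Words, streams and sums\<close>

lemma sublist_pair_iff:
  "sublist [x, y] w \<longleftrightarrow> (\<exists>i. Suc i < length w \<and> w ! i = x \<and> w ! Suc i = y)"
proof
  assume "sublist [x, y] w"
  then obtain ps ss where "w = ps @ [x, y] @ ss"
    by (auto simp: sublist_def)
  then show "\<exists>i. Suc i < length w \<and> w ! i = x \<and> w ! Suc i = y"
    by (intro exI[of _ "length ps"]) (simp add: nth_append)
next
  assume "\<exists>i. Suc i < length w \<and> w ! i = x \<and> w ! Suc i = y"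
  then obtain i where i: "Suc i < length w" "w ! i = x" "w ! Suc i = y"
    by blast
  then have "w = take i w @ [x, y] @ drop (Suc (Suc i)) w"
    by (metis Cons_nth_drop_Suc Suc_lessD append.left_neutral append_Cons append_take_drop_id)
  then show "sublist [x, y] w"
    by (metis sublist_appendI)
qed

lemma length_concat_map_const:
  assumes "\<And>x. length (f x) = L"
  shows "length (concat (map f w)) = L * length w"
  using assms by (induction w) auto

lemma nth_concat_map_const:
  assumes "\<And>x. length (f x) = L" "s < length w" "i < L"
  shows "concat (map f w) ! (L * s + i) = f (w ! s) ! i"
  using assms
proof (induction w arbitrary: s)
  case (Cons x w)
  then show ?case by (cases s) (auto simp: nth_append)
qed simp

lemma snth_flat_smap_const:
  assumes "\<And>x. length (f x) = L" "i < L"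
  shows "flat (smap f v) !! (L * n + i) = f (v !! n) ! i"
  using assms
proof (induction n arbitrary: v)
  case 0
  have "f (shd v) \<noteq> []"
    using 0 by (metis length_0_conv not_less0)
  with 0 show ?case by (simp add: flat_unfold)
next
  case (Suc n)
  have "f (shd v) \<noteq> []"
    using Suc.prems by (metis length_0_conv not_less0)
  with Suc.prems have "flat (smap f v) !! (L * Suc n + i) = flat (smap f (stl v)) !! (L * n + i)"
    by (simp add: flat_unfold shift_snth_ge)
  also have "\<dots> = f (stl v !! n) ! i"
    using Suc.prems by (rule Suc.IH)
  finally show ?case by simp
qed

lemma snth_cycle:
  assumes "u \<noteq> []"
  shows "cycle u !! n = u ! (n mod length u)"
proof (induction n rule: less_induct)
  case (less n)
  show ?case
  proof (cases "n < length u")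
    case True
    then show ?thesis
      by (subst cycle_decomp[OF assms]) simp
  next
    case False
    then have "cycle u !! n = cycle u !! (n - length u)"
      by (subst cycle_decomp[OF assms]) simp
    also have "\<dots> = u ! ((n - length u) mod length u)"
      using False assms by (intro less diff_less) (auto simp: not_less intro: less_le_trans[of 0 "length u"])
    finally show ?thesis
      using False by (simp add: le_mod_geq)
  qed
qed

text \<open>On a finite alphabet an injective \<open>\<tau>\<close> is a permutation, so the orbit
  that \<open>v\<close> follows returns to its starting letter and repeats.\<close>

lemma stream_eq_cycleI:
  fixes v :: "'a::finite stream"
  assumes "inj \<tau>" and step: "\<And>n. v !! Suc n = \<tau> (v !! n)"
  shows "\<exists>u. u \<noteq> [] \<and> v = cycle u"
proof -
  have pow: "v !! (m + n) = (\<tau> ^^ n) (v !! m)" for m n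
    by (induction n) (simp_all add: step del: snth.simps)
  obtain p where p: "p > 0" "(\<tau> ^^ p) (v !! 0) = v !! 0"
    using funpow_inj_finite[OF assms(1) finite[of "{y. \<exists>n. y = (\<tau> ^^ n) (v !! 0)}"]] by blast
  have per: "v !! (n + p) = v !! n" for n
    by (metis add.commute add_0 p(2) pow)
  have "v !! n = v !! (n mod p)" for n
  proof (induction n rule: less_induct)
    case (less n)
    then show ?case
      using per[of "n - p"] p(1) by (cases "n < p") (auto simp: le_mod_geq)
  qed
  moreover have "stake p v \<noteq> []"
    using p(1) by (cases p) simp_all
  ultimately have "v !! n = cycle (stake p v) !! n" for n
    using p(1) by (simp add: snth_cycle)
  then have "v = cycle (stake p v)"
    by (metis ext stream_smap_nats)
  with \<open>stake p v \<noteq> []\<close> show ?thesis by blast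
qed

lemma digit_bound:
  fixes A B s t :: nat
  assumes "s < A" "t < B"
  shows "B * s + t < B * A"
proof -
  have "B * s + t < B * Suc s" using assms by simp
  also have "\<dots> \<le> B * A" using assms by (intro mult_le_mono2) simp
  finally show ?thesis .
qed

lemma repunit_mult_nat:
  fixes b :: nat
  assumes "b \<ge> 1"
  shows "(b - 1) * (\<Sum>i<M. b ^ i) = b ^ M - 1"
proof -
  obtain c where "b = Suc c"
    using \<open>b \<ge> 1\<close> by (cases b) auto
  then show ?thesis
    by (induction M) (auto simp: algebra_simps)
qed

section \<open>Columns of iterates\<close>

locale fixed_length_substitution =
  fixes \<rho> :: "'a::finite \<Rightarrow> 'a list" and L :: nat
  assumes length_eq: "constant_length \<rho> L" and L_pos: "0 < L"
begin

lemma length_subst_iter: "length (subst_iter \<rho> K a) = L ^ K"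
  using length_eq
  by (induction K)
    (auto simp: subst_iter_def subst_word_def constant_length_def length_concat_map_const[where L=L])

abbreviation col :: "nat \<Rightarrow> nat \<Rightarrow> 'a \<Rightarrow> 'a" where
  "col K \<equiv> column (subst_iter \<rho> K)"

lemma col_0: "col 0 0 = id"
  by (auto simp: column_def subst_iter_def)

text \<open>The substitution applied last refines single letters, so it contributes the least
  significant digit of the position and the outermost map.\<close>

lemma col_Suc:
  assumes "s < L ^ K" "i < L"
  shows "col (Suc K) (L * s + i) = column \<rho> i \<circ> col K s"
proof
  fix a
  have "subst_iter \<rho> (Suc K) a = concat (map \<rho> (subst_iter \<rho> K a))"
    by (simp add: subst_iter_def subst_word_def)
  then show "col (Suc K) (L * s + i) a = (column \<rho> i \<circ> col K s) a"
    using assms length_eq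
    by (simp add: column_def constant_length_def nth_concat_map_const[where L=L] length_subst_iter)
qed

text \<open>Induction on the base \<open>L\<close> digits of \<open>s\<close>, most significant
  first. \<open>K\<close> is their number, so leading zeros count as digits.\<close>

lemma col_induct [consumes 1, case_names 0 Suc]:
  assumes "s < L ^ K"
    and "P 0 0"
    and "\<And>K s i. s < L ^ K \<Longrightarrow> i < L \<Longrightarrow> P K s \<Longrightarrow> P (Suc K) (L * s + i)"
  shows "P K s"
  using assms(1)
proof (induction K arbitrary: s)
  case 0
  then show ?case using assms(2) by simp
next
  case (Suc K)
  have "s div L < L ^ K"
    using Suc.prems by (simp add: less_mult_imp_div_less mult.commute)
  moreover have "s mod L < L"
    using L_pos by simp
  ultimately have "P (Suc K) (L * (s div L) + s mod L)"
    using Suc.IH assms(3) by blast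
  then show ?case by simp
qed

lemma col_add:
  assumes "s < L ^ K" "t < L ^ K'"
  shows "col (K + K') (L ^ K' * s + t) = col K' t \<circ> col K s"
  using assms(2)
proof (induction rule: col_induct)
  case 0
  then show ?case by (simp add: col_0)
next
  case (Suc K' t i)
  have "L ^ K' * s + t < L ^ (K + K')"
    using digit_bound[OF assms(1) Suc(1)] by (simp add: power_add mult.commute)
  then have "col (Suc (K + K')) (L * (L ^ K' * s + t) + i) = column \<rho> i \<circ> (col K' t \<circ> col K s)"
    using Suc by (simp only: col_Suc)
  also have "\<dots> = col (Suc K') (L * t + i) \<circ> col K s"
    using Suc(1,2) by (simp only: col_Suc o_assoc)
  finally show ?case
    by (simp add: algebra_simps)
qed

lemma bij_col:
  assumes "bijective_subst \<rho> L" "s < L ^ K"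
  shows "bij (col K s)"
  using assms(2)
proof (induction rule: col_induct)
  case 0
  show ?case by (simp only: col_0 bij_id)
next
  case (Suc K s i)
  have "bij (column \<rho> i)"
    using assms(1) Suc(2) by (simp add: bijective_subst_def)
  with Suc show ?case by (simp only: col_Suc bij_comp)
qed

lemma col_left:
  assumes "column \<rho> 0 = id"
  shows "col K 0 = id"
  using col_Suc[of 0 _ 0] assms L_pos by (induction K) (auto simp: col_0)

lemma snth_fixed_point:
  assumes "fixed_point \<rho> v" "s < L ^ K"
  shows "v !! (L ^ K * n + s) = col K s (v !! n)"
  using assms(2)
proof (induction rule: col_induct)
  case 0
  then show ?case by (simp add: col_0)
next
  case (Suc K s i)
  have "v !! (L * m + i) = column \<rho> i (v !! m)" for m
    using snth_flat_smap_const[of \<rho> L i v m] assms(1) length_eq Suc(2)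
    by (simp add: fixed_point_def subst_stream_def column_def constant_length_def)
  from this[of "L ^ K * n + s"] have "v !! (L * (L ^ K * n + s) + i) = col (Suc K) (L * s + i) (v !! n)"
    by (simp only: Suc.IH col_Suc[OF Suc(1,2)] comp_apply)
  then show ?case
    by (simp add: algebra_simps)
qed

section \<open>Legal words of length 2 and primitivity\<close>

lemma legal_pair_iff:
  "legal \<rho> [x, y] \<longleftrightarrow> (\<exists>K s a. Suc s < L ^ K \<and> x = col K s a \<and> y = col K (Suc s) a)"
  unfolding legal_def sublist_pair_iff length_subst_iter column_def by blast

text \<open>As \<open>L \<ge> 2\<close>, the prefix
  \<open>subst_iter \<rho> (n + 2) (v !! 0)\<close> of \<open>v\<close> is long enough to contain
  the pair.\<close>

lemma legal_pair_fixed_point: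
  assumes "fixed_point \<rho> v" "L \<ge> 2"
  shows "legal \<rho> [v !! n, v !! Suc n]"
proof -
  have "n + 2 \<le> 2 ^ (n + 2)"
    using less_exp[of "n + 2"] by linarith
  also have "\<dots> \<le> L ^ (n + 2)"
    using assms(2) by (intro power_mono) auto
  finally have "Suc n < L ^ (n + 2)" by simp
  moreover from this have "v !! n = col (n + 2) n (v !! 0)" "v !! Suc n = col (n + 2) (Suc n) (v !! 0)"
    using snth_fixed_point[OF assms(1), of n "n + 2" 0] snth_fixed_point[OF assms(1), of "Suc n" "n + 2" 0]
    by (simp_all del: snth.simps(2))
  ultimately show ?thesis
    unfolding legal_pair_iff by blast
qed

lemma primitive_col:
  assumes "primitive_subst \<rho>"
  obtains K where "\<And>a b. \<exists>s<L ^ K. col K s a = b"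
proof -
  obtain K where K: "\<And>a. set (subst_iter \<rho> K a) = UNIV"
    using assms by (auto simp: primitive_subst_def)
  have "\<exists>s<L ^ K. col K s a = b" for a b
    using K[of a] length_subst_iter[of K a] by (metis UNIV_I column_def in_set_conv_nth)
  then show ?thesis using that by blast
qed

text \<open>The \<open>LEAST\<close> has its property only if some exponent has it. There are
  finitely many legal pairs, each inside an iterate of some letter \<open>b\<close>. By primitivity
  \<open>b\<close> occurs in \<open>subst_iter \<rho> K0 a\<close> for every \<open>a\<close>, and a
  common further exponent \<open>M\<close> serves all pairs.\<close>

lemma legal_pairs_index_sublist:
  assumes "primitive_subst \<rho>" "column \<rho> 0 = id" "legal \<rho> [x, y]"
  shows "sublist [x, y] (subst_iter \<rho> (legal_pairs_index \<rho>) a)"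
proof -
  define W where "W = {w. legal \<rho> w \<and> length w = 2}"
  have "finite W"
    by (rule finite_subset[OF _ finite_lists_length_eq[OF finite_UNIV, of 2]]) (auto simp: W_def)
  have "\<forall>w\<in>W. \<exists>K s b. Suc s < L ^ K \<and> w = [col K s b, col K (Suc s) b]"
    unfolding W_def
    by (auto simp: numeral_2_eq_2 length_Suc_conv legal_pair_iff)
  then obtain K s b where w:
    "\<And>w. w \<in> W \<Longrightarrow> Suc (s w) < L ^ K w \<and> w = [col (K w) (s w) (b w), col (K w) (Suc (s w)) (b w)]"
    by metis
  obtain K0 where K0: "\<And>a b. \<exists>s<L ^ K0. col K0 s a = b"
    using primitive_col[OF assms(1)] by blast
  \<comment> \<open>Inserting 0 keeps the set nonempty even if there are no legal pairs.\<close>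
  define M where "M = Max (insert 0 (K ` W))"
  have "sublist w (subst_iter \<rho> (K0 + M) a)" if "w \<in> W" for w a
  proof -
    have "K w \<le> M"
      using \<open>finite W\<close> that by (auto simp: M_def)
    then obtain e where e: "M = e + K w"
      by (metis add.commute le_Suc_ex)
    obtain t where t: "t < L ^ K0" "col K0 t a = b w"
      using K0 by blast
    \<comment> \<open>As the leftmost column is the identity, iterating the substitution only extends words to the right.\<close>
    have shift: "col (K0 + M) (L ^ M * t + r) a = col (K w) r (b w)" if "r < L ^ K w" for r
    proof -
      have "col M r = col (K w) r"
        using col_add[of 0 e r "K w"] that L_pos by (simp add: e col_left[OF assms(2)])
      moreover have "L ^ K w \<le> L ^ M"
        using L_pos \<open>K w \<le> M\<close> by (simp add: power_increasing)
      ultimately show ?thesis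
        using col_add[of t K0 r M] t that by simp
    qed
    have "L ^ M * t + Suc (s w) < L ^ (K0 + M)"
    proof -
      have "Suc (s w) < L ^ M"
        using w[OF that] power_increasing[OF \<open>K w \<le> M\<close>, of L] L_pos by linarith
      from digit_bound[OF t(1) this] show ?thesis
        by (simp add: power_add mult.commute)
    qed
    moreover have "w = [col (K0 + M) (L ^ M * t + s w) a, col (K0 + M) (Suc (L ^ M * t + s w)) a]"
      using w[OF that] shift[of "s w"] shift[of "Suc (s w)"] by simp
    ultimately show ?thesis
      by (metis add_Suc_right column_def length_subst_iter sublist_pair_iff)
  qed
  then have "\<forall>a w. legal \<rho> w \<and> length w = 2 \<longrightarrow> sublist w (subst_iter \<rho> (K0 + M) a)"
    by (simp add: W_def)
  then have "\<forall>a w. legal \<rho> w \<and> length w = 2 \<longrightarrow> sublist w (subst_iter \<rho> (legal_pairs_index \<rho>) a)"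
    unfolding legal_pairs_index_def by (rule LeastI)
  then show ?thesis
    using assms(3) by simp
qed

section \<open>The column group\<close>

lemma column_group_mult:
  assumes "f \<in> carrier (column_group \<rho> L)" "g \<in> carrier (column_group \<rho> L)"
  shows "f \<otimes>\<^bsub>column_group \<rho> L\<^esub> g = f \<circ> g"
proof -
  have "f \<in> Bij UNIV" "g \<in> Bij UNIV"
    using assms group.carrier_subgroup_generated_subset[OF group_BijGroup]
    by (auto simp: column_group_def BijGroup_def)
  then show ?thesis
    by (auto simp: column_group_def subgroup_generated_def BijGroup_def compose_def)
qed

lemma column_group_one: "\<one>\<^bsub>column_group \<rho> L\<^esub> = id"
  by (auto simp: column_group_def subgroup_generated_def BijGroup_def)

lemma group_column_group: "group (column_group \<rho> L)"
  unfolding column_group_def by (intro group.group_subgroup_generated group_BijGroup)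

lemma col_in_column_group:
  assumes "bijective_subst \<rho> L" "s < L ^ K"
  shows "col K s \<in> carrier (column_group \<rho> L)"
  using assms(2)
proof (induction rule: col_induct)
  case 0
  then show ?case
    using group.is_monoid[OF group_column_group, THEN monoid.one_closed]
    by (simp only: col_0 column_group_one)
next
  case (Suc K s i)
  have "column \<rho> i \<in> carrier (column_group \<rho> L)"
    using assms(1) Suc(2) unfolding column_group_def carrier_subgroup_generated
    by (intro generate.incl) (auto simp: BijGroup_def Bij_def bijective_subst_def)
  then show ?case
    using Suc monoid.m_closed[OF group.is_monoid[OF group_column_group]]
    by (metis col_Suc column_group_mult)
qed

lemma col_commute:
  assumes "bijective_subst \<rho> L" "comm_group (column_group \<rho> L)" "s < L ^ K" "t < L ^ K'"
  shows "col K s (col K' t a) = col K' t (col K s a)"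
proof -
  have "comm_monoid (column_group \<rho> L)"
    using assms(2) by (rule comm_group.axioms)
  from comm_monoid.m_comm[OF this col_in_column_group col_in_column_group, OF assms(1,3,1,4)]
  have "col K s \<circ> col K' t = col K' t \<circ> col K s"
    using assms by (simp add: column_group_mult col_in_column_group)
  then show ?thesis by (metis comp_apply)
qed

lemma funpow_order_column_group:
  assumes "f \<in> carrier (column_group \<rho> L)"
  shows "f ^^ order (column_group \<rho> L) = id"
proof -
  interpret G: group "column_group \<rho> L" by (rule group_column_group)
  have "f [^]\<^bsub>column_group \<rho> L\<^esub> n = f ^^ n" for n :: nat
  proof (induction n)
    case (Suc n)
    then have "f [^]\<^bsub>column_group \<rho> L\<^esub> Suc n = f ^^ n \<circ> f"
      using assms G.nat_pow_closed[OF assms, of n] by (simp add: column_group_mult)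
    then show ?case by (simp only: funpow_Suc_right)
  qed (simp add: column_group_one)
  then show ?thesis
    using G.pow_order_eq_1[OF assms] by (simp add: column_group_one)
qed

text \<open>Primitivity makes the columns of iterates transitive, so one of them moves
  \<open>x\<close> to \<open>y\<close>. The bound gives the repunit at least two digits.\<close>

lemma order_column_group_ge_2:
  assumes "bijective_subst \<rho> L" "primitive_subst \<rho>" "(x::'a) \<noteq> y"
  shows "order (column_group \<rho> L) \<ge> 2"
proof -
  obtain K where "\<And>a b. \<exists>s<L ^ K. col K s a = b"
    using primitive_col[OF assms(2)] by blast
  then obtain s where s: "s < L ^ K" "col K s x = y" by blast
  then have "col K s \<noteq> id" using assms(3) by auto
  moreover have "id \<in> carrier (column_group \<rho> L)"
    using group.is_monoid[OF group_column_group, THEN monoid.one_closed]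
    by (simp add: column_group_one)
  ultimately have "card {id, col K s} \<le> order (column_group \<rho> L)"
    unfolding order_def using s assms(1)
    by (intro card_mono) (auto simp: col_in_column_group)
  then show ?thesis using \<open>col K s \<noteq> id\<close> by simp
qed

section \<open>Long progressions\<close>

lemma lower_progression:
  assumes "bijective_subst \<rho> L" "fixed_point \<rho> v" "n < L ^ k"
  shows "v !! (n * (\<Sum>i<order (column_group \<rho> L). (L ^ k) ^ i)) = v !! 0"
proof -
  have "v !! (n * (\<Sum>i<M. (L ^ k) ^ i)) = (col k n ^^ M) (v !! 0)" for M
  proof (induction M)
    case (Suc M)
    \<comment> \<open>Appending one more digit \<open>n\<close> in base \<open>L ^ k\<close> applies
      \<open>col k n\<close> once more.\<close>
    have "n * (\<Sum>i<Suc M. (L ^ k) ^ i) = L ^ k * (n * (\<Sum>i<M. (L ^ k) ^ i)) + n"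
      by (subst sum.lessThan_Suc_shift) (simp add: sum_distrib_left algebra_simps)
    then show ?case
      using snth_fixed_point[OF assms(2,3)] Suc by simp
  qed simp
  then show ?thesis
    using funpow_order_column_group[OF col_in_column_group[OF assms(1,3)]] by simp
qed

section \<open>From a long progression to a long period\<close>

text \<open>As \<open>d \<le> L ^ e\<close>, the progression skips no block of length
  \<open>L ^ e\<close>. The last \<open>L ^ e\<close> steps are reserved for reaching block
  \<open>t + d\<close>; the other \<open>L ^ e * (P - 1)\<close> steps cover
  \<open>d * (P - 1)\<close> blocks.\<close>

lemma progression_imp_period:
  assumes "bijective_subst \<rho> L" "fixed_point \<rho> v"
    and "0 < d" "d \<le> L ^ e"
    and prog: "\<And>n. n \<le> L ^ e * P \<Longrightarrow> v !! j = v !! (j + d * n)"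
    and "t \<le> d * (P - 1)" "P \<ge> 1"
  shows "v !! (j div L ^ e + t) = v !! (j div L ^ e + t + d)"
proof -
  define D where "D = L ^ e"
  define q r where "q = j div D" and "r = j mod D"
  have "D > 0" using L_pos by (simp add: D_def)
  have j: "j = D * q + r" "r < D"
    using \<open>D > 0\<close> by (simp_all add: q_def r_def)
  \<comment> \<open>D steps of the progression advance it by exactly d blocks, so blocks t and t + d meet it at the same offset x.\<close>
  obtain x n where xn: "x < D" "n \<le> D * (P - 1)" "D * (q + t) + x = j + d * n"
  \<comment> \<open>The two extreme blocks are met at the offset \<open>r\<close> of
    \<open>j\<close> itself.\<close>
  proof (cases "t = 0 \<or> t = d * (P - 1)")
    case True
    then show ?thesis
    proof
      assume "t = 0"
      then show ?thesis using that[of r 0] j by simp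
    next
      assume "t = d * (P - 1)"
      then show ?thesis using that[of r "D * (P - 1)"] j by (simp add: algebra_simps)
    qed
  next
    case False
    \<comment> \<open>\<open>y\<close> is the distance from \<open>j\<close> to the start of block
      \<open>q + t\<close>, and \<open>n\<close>, which is \<open>y / d\<close> rounded up, indexes
      the first term not before that start.\<close>
    define y where "y = D * t - r"
    have "D \<le> D * t" using False by simp
    then have y: "y + r = D * t" using j(2) by (simp only: y_def le_add_diff_inverse2 less_imp_le less_le_trans)
    define n where "n = (y + (d - 1)) div d"
    have n1: "d * n \<le> y + (d - 1)"
      by (simp add: n_def)
    have n2: "y \<le> d * n"
      using dividend_less_times_div[OF \<open>0 < d\<close>, of "y + (d - 1)"] \<open>0 < d\<close>
      by (simp add: n_def)
    have "d * n < y + d" using n1 \<open>0 < d\<close> by simp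
    also have "\<dots> \<le> D * t + D" using y assms(4) by (simp add: D_def)
    also have "\<dots> = D * Suc t" by simp
    also have "\<dots> \<le> D * (d * (P - 1))"
      using False assms(6) by (intro mult_le_mono2) simp
    finally have "n \<le> D * (P - 1)"
      by (simp add: mult.left_commute)
    moreover have "d * n - y < D"
      using n1 assms(3,4) by (simp add: D_def)
    moreover have "D * (q + t) + (d * n - y) = j + d * n"
      using n2 y j by (simp add: algebra_simps)
    ultimately show ?thesis using that by blast
  qed
  have "D * (P - 1) + D = D * P"
    using \<open>P \<ge> 1\<close> by (simp add: algebra_simps)
  then have "n + D \<le> D * P" using xn(2) by linarith
  have "col e x (v !! (q + t)) = v !! j"
    using snth_fixed_point[OF assms(2), of x e "q + t"] prog[of n] xn \<open>n + D \<le> D * P\<close>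
    by (simp add: D_def)
  moreover have "D * (q + t + d) + x = j + d * (n + D)"
    using xn(3) by (simp add: algebra_simps)
  then have "col e x (v !! (q + t + d)) = v !! j"
    using snth_fixed_point[OF assms(2), of x e "q + t + d"] prog[of "n + D"] xn \<open>n + D \<le> D * P\<close>
    by (simp add: D_def)
  ultimately show ?thesis
    using bij_col[OF assms(1)] xn(1) unfolding q_def D_def by (metis bij_is_inj injD)
qed

section \<open>Steps between neighbouring letters of a block\<close>

definition col_step :: "nat \<Rightarrow> nat \<Rightarrow> 'a \<Rightarrow> 'a" where
  "col_step K s = col K (Suc s) \<circ> inv_into UNIV (col K s)"

lemma col_step_col:
  assumes "bijective_subst \<rho> L" "Suc s < L ^ K"
  shows "col_step K s (col K s a) = col K (Suc s) a"
  using bij_col[OF assms(1), of s K] assms(2)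
  by (simp add: col_step_def bij_is_inj inv_f_f)

text \<open>Writing the argument as \<open>col K s b\<close> removes the inverse from the step, so
  commutation of columns suffices.\<close>

lemma col_step_commute:
  assumes "bijective_subst \<rho> L" "comm_group (column_group \<rho> L)" "Suc s < L ^ K" "t < L ^ K'"
  shows "col_step K s (col K' t a) = col K' t (col_step K s a)"
proof -
  obtain b where b: "a = col K s b"
    using bij_col[OF assms(1), of s K] assms(3) by (metis Suc_lessD bij_pointE)
  show ?thesis
    using assms by (metis Suc_lessD b col_commute col_step_col)
qed

text \<open>A transitive Abelian permutation group acts freely, so a step is determined by one of its values.\<close>

lemma col_step_eqI:
  assumes "bijective_subst \<rho> L" "comm_group (column_group \<rho> L)" "primitive_subst \<rho>"
    and "Suc s < L ^ K" "Suc s' < L ^ K" "col_step K s x = col_step K s' x"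
  shows "col_step K s = col_step K s'"
proof
  fix y
  obtain K0 where "\<And>a b. \<exists>t<L ^ K0. col K0 t a = b"
    using primitive_col[OF assms(3)] by blast
  then obtain t where "t < L ^ K0" "col K0 t x = y" by blast
  then show "col_step K s y = col_step K s' y"
    using assms by (metis col_step_commute)
qed

text \<open>The period makes both steps carry the same letter to the same letter, and freeness makes
  them equal. The last offset of a block is excluded because the pair there straddles two
  blocks.\<close>

lemma period_imp_col_step_shift:
  assumes bij: "bijective_subst \<rho> L" and comm: "comm_group (column_group \<rho> L)"
    and prim: "primitive_subst \<rho>" and fp: "fixed_point \<rho> v"
    and "L ^ N \<le> W"
    and per: "\<And>t. t \<le> W \<Longrightarrow> v !! (q + t) = v !! (q + t + d)"
    and s: "Suc s < L ^ N" "Suc ((s + d) mod L ^ N) < L ^ N"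
  shows "col_step N s = col_step N ((s + d) mod L ^ N)"
proof -
  define P where "P = L ^ N"
  have "P > 0" using L_pos by (simp add: P_def)
  have val: "v !! n = col N (n mod P) (v !! (n div P))" for n
    using snth_fixed_point[OF fp, of "n mod P" N "n div P"] \<open>P > 0\<close> by (simp add: P_def)
  have step: "v !! Suc n = col_step N (n mod P) (v !! n)" if "Suc (n mod P) < P" for n
  proof -
    have "Suc n mod P = Suc (n mod P)" "Suc n div P = n div P"
      using that by (simp_all add: mod_Suc div_Suc)
    then show ?thesis
      using val[of n] val[of "Suc n"] col_step_col[OF bij, of "n mod P" N] that
      by (simp add: P_def)
  qed
  \<comment> \<open>This \<open>t\<close> places \<open>q + t\<close> at offset \<open>s\<close>.
    Since \<open>t < P\<close>, both \<open>t\<close> and \<open>Suc t\<close> lie in the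
    window.\<close>
  define t where "t = (s + (P - q mod P)) mod P"
  have "t < P" using \<open>P > 0\<close> by (simp add: t_def)
  have "(q + t) mod P = (q mod P + (s + (P - q mod P))) mod P"
    by (simp only: t_def mod_add_eq mod_add_left_eq mod_add_right_eq)
  also have "q mod P + (s + (P - q mod P)) = s + P"
    using mod_less_divisor[OF \<open>P > 0\<close>, of q] by simp
  finally have qt: "(q + t) mod P = s"
    using s(1) by (simp add: P_def)
  then have qtd: "(q + t + d) mod P = (s + d) mod P"
    by (metis mod_add_left_eq)
  have eq: "v !! (q + t) = v !! (q + t + d)" "v !! Suc (q + t) = v !! Suc (q + t + d)"
    using per[of t] per[of "Suc t"] \<open>t < P\<close> \<open>L ^ N \<le> W\<close> by (simp_all add: P_def)
  have "col_step N s (v !! (q + t)) = col_step N ((s + d) mod P) (v !! (q + t))"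
    using step[of "q + t"] step[of "q + t + d"] qt qtd eq s by (simp add: P_def)
  then show ?thesis
    using col_step_eqI[OF bij comm prim] s by (simp add: P_def)
qed

text \<open>Adding \<open>d\<close> permutes the offsets modulo \<open>L ^ N\<close> in a single
  cycle; without the last offset of a block it stays connected. The reference \<open>d - 1\<close>
  is the offset following the removed one.\<close>

lemma period_imp_col_step_const:
  assumes bij: "bijective_subst \<rho> L" and comm: "comm_group (column_group \<rho> L)"
    and prim: "primitive_subst \<rho>" and fp: "fixed_point \<rho> v"
    and "L ^ N \<le> W" and "d \<ge> 1" "coprime d L"
    and per: "\<And>t. t \<le> W \<Longrightarrow> v !! (q + t) = v !! (q + t + d)"
    and s: "Suc s < L ^ N"
  shows "col_step N s = col_step N ((d - 1) mod L ^ N)"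
proof -
  define P where "P = L ^ N"
  have "P \<ge> 2" using s by (simp add: P_def)
  have cop: "coprime d P" using \<open>coprime d L\<close> by (simp add: P_def)
  \<comment> \<open>The residues other than P - 1 form a single chain under adding d, namely those of i d - 1 for 0 < i < P.\<close>
  have bound: "Suc ((i * d - 1) mod P) < P" if "0 < i" "i < P" for i
  proof -
    have "\<not> P dvd i * d"
      using that cop by (metis coprime_commute coprime_dvd_mult_left_iff nat_dvd_not_less)
    moreover have "Suc (i * d - 1) = i * d"
      using that \<open>d \<ge> 1\<close> by simp
    ultimately have "Suc (i * d - 1) mod P \<noteq> 0"
      by (simp add: dvd_eq_mod_eq_0)
    then show ?thesis
      using \<open>P \<ge> 2\<close> by (simp add: mod_Suc Suc_lessI split: if_splits)
  qed
  have chain: "i < P \<longrightarrow> col_step N ((i * d - 1) mod P) = col_step N ((d - 1) mod P)" if "1 \<le> i" for i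
    using that
  proof (induction i rule: dec_induct)
    case base
    then show ?case by simp
  next
    case (step i)
    have eq: "((i * d - 1) mod P + d) mod P = (Suc i * d - 1) mod P"
    proof -
      have "1 \<le> i * d" using step(1) \<open>d \<ge> 1\<close> by simp
      then have "i * d - 1 + d = Suc i * d - 1" by simp
      then show ?thesis by (metis mod_add_left_eq)
    qed
    show ?case
    proof
      assume "Suc i < P"
      then have "col_step N ((i * d - 1) mod P) = col_step N ((Suc i * d - 1) mod P)"
        using period_imp_col_step_shift[OF bij comm prim fp \<open>L ^ N \<le> W\<close> per, of "(i * d - 1) mod P"]
          bound[of i] bound[of "Suc i"] step(1) eq
        by (simp add: P_def)
      then show "col_step N ((Suc i * d - 1) mod P) = col_step N ((d - 1) mod P)"
        using step \<open>Suc i < P\<close> by simp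
    qed
  qed
  \<comment> \<open>The inverse of \<open>d\<close> modulo \<open>P\<close> locates \<open>s\<close>
    in the chain: \<open>i * d\<close> must be congruent to \<open>Suc s\<close>.\<close>
  obtain y where "[d * y = Suc 0] (mod P)"
    using cong_solve_coprime_nat[OF cop] by blast
  from cong_scalar_right[OF this, of "Suc s"] have x: "[d * (y * Suc s) = Suc s] (mod P)"
    by (simp only: mult.assoc mult_Suc mult_0 add_0_right)
  define i where "i = y * Suc s mod P"
  have "[d * i = Suc s] (mod P)"
    using x unfolding i_def cong_def by (simp only: mod_mult_right_eq)
  then have i: "(i * d) mod P = Suc s"
    using s by (simp add: cong_def P_def mult.commute)
  then have "1 \<le> i"
    by (cases i) auto
  then have "Suc ((i * d - 1) mod P) mod P = Suc s"
    using i \<open>d \<ge> 1\<close> by (simp add: mod_Suc_eq)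
  then have "(i * d - 1) mod P = s"
    by (auto simp: mod_Suc split: if_splits)
  moreover have "i < P"
    using \<open>P \<ge> 2\<close> by (simp add: i_def)
  ultimately show ?thesis
    using chain[OF \<open>1 \<le> i\<close>] by (simp add: P_def)
qed

lemma inj_col_step:
  assumes "bijective_subst \<rho> L" "Suc s < L ^ K"
  shows "inj (col_step K s)"
  unfolding col_step_def
  using bij_col[OF assms(1), of s K] bij_col[OF assms(1), of "Suc s" K] assms(2)
  by (intro inj_compose) (auto simp: bij_is_inj bij_imp_bij_inv)

lemma no_long_period:
  assumes bij: "bijective_subst \<rho> L" and comm: "comm_group (column_group \<rho> L)"
    and prim: "primitive_subst \<rho>" and ap: "aperiodic_subst \<rho>" and left: "column \<rho> 0 = id"
    and fp: "fixed_point \<rho> v" and N: "N = legal_pairs_index \<rho>"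
    and "L \<ge> 2" "d \<ge> 2" "coprime d L"
    and per: "\<And>t. t \<le> d * (L ^ N - 1) \<Longrightarrow> v !! (q + t) = v !! (q + t + d)"
  shows False
proof -
  have legal_N: "\<exists>s a. Suc s < L ^ N \<and> x = col N s a \<and> y = col N (Suc s) a" if "legal \<rho> [x, y]" for x y
    using legal_pairs_index_sublist[OF prim left that]
    unfolding sublist_pair_iff length_subst_iter N column_def by metis
  \<comment> \<open>The first two letters of \<open>v\<close> form a legal pair, which has to fit
    into a block.\<close>
  have "2 \<le> L ^ N"
    using legal_N[OF legal_pair_fixed_point[OF fp \<open>L \<ge> 2\<close>, of 0]] by auto
  \<comment> \<open>Here \<open>d \<ge> 2\<close> is what makes the window long enough to meet every
    offset.\<close>
  have "L ^ N \<le> 2 * (L ^ N - 1)"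
    using \<open>2 \<le> L ^ N\<close> by simp
  also have "\<dots> \<le> d * (L ^ N - 1)"
    using \<open>d \<ge> 2\<close> by (rule mult_le_mono1)
  finally have W: "L ^ N \<le> d * (L ^ N - 1)" .
  have "d \<ge> 1" using \<open>d \<ge> 2\<close> by simp
  note const = period_imp_col_step_const[OF bij comm prim fp W this \<open>coprime d L\<close> per]
  define \<tau> where "\<tau> = col_step N ((d - 1) mod L ^ N)"
  \<comment> \<open>The pair may straddle two blocks of \<open>v\<close>, but being legal it also
    occurs inside some block, where the step is \<open>\<tau>\<close>.\<close>
  have "v !! Suc n = \<tau> (v !! n)" for n
    using legal_N[OF legal_pair_fixed_point[OF fp \<open>L \<ge> 2\<close>, of n]] const col_step_col[OF bij]
    unfolding \<tau>_def by metis
  moreover have "inj \<tau>"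
    using inj_col_step[OF bij, of 0 N] const[of 0] \<open>2 \<le> L ^ N\<close> by (simp add: \<tau>_def)
  ultimately obtain u where "u \<noteq> []" "v = cycle u"
    using stream_eq_cycleI by blast
  then show False
    using ap fp by (auto simp: aperiodic_subst_def)
qed

section \<open>Degenerate cases and the two bounds\<close>

lemma aperiodic_imp_two_letters:
  assumes "aperiodic_subst \<rho>" "fixed_point \<rho> v"
  shows "\<exists>x y :: 'a. x \<noteq> y"
proof (rule ccontr)
  assume "\<nexists>x y :: 'a. x \<noteq> y"
  then have "v !! Suc n = id (v !! n)" for n by auto
  then obtain u where "u \<noteq> []" "v = cycle u"
    using stream_eq_cycleI inj_on_id by blast
  then show False
    using assms by (auto simp: aperiodic_subst_def)
qed

text \<open>For \<open>L = 1\<close> the identity is the only column of each iterate, which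
  contradicts transitivity on two letters.\<close>

lemma length_ge_2:
  assumes "primitive_subst \<rho>" "column \<rho> 0 = id" "(x::'a) \<noteq> y"
  shows "L \<ge> 2"
proof (rule ccontr)
  assume "\<not> L \<ge> 2"
  then have "L = 1" using L_pos by simp
  obtain K where "\<And>a b. \<exists>s<L ^ K. col K s a = b"
    using primitive_col[OF assms(1)] by blast
  then show False
    using assms(3) col_left[OF assms(2)] \<open>L = 1\<close> by (metis id_apply less_one power_one)
qed

lemma max_monochromatic_repunit_bounds:
  assumes "aperiodic_subst \<rho>"
    and "primitive_subst \<rho>"
    and "bijective_subst \<rho> L"
    and "column \<rho> 0 = id"
    and "comm_group (column_group \<rho> L)"
    and "N = legal_pairs_index \<rho>"
    and "fixed_point \<rho> v"
    and "k \<ge> 1"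
  shows "enat (L ^ k) \<le>
      max_monochromatic v ((L ^ (k * order (column_group \<rho> L)) - 1) div (L ^ k - 1)) \<and>
    max_monochromatic v ((L ^ (k * order (column_group \<rho> L)) - 1) div (L ^ k - 1))
      \<le> enat (L ^ (k * order (column_group \<rho> L) + N))"
proof -
  obtain x y :: 'a where "x \<noteq> y"
    using aperiodic_imp_two_letters[OF assms(1,7)] by blast
  note L2 = length_ge_2[OF assms(2,4) this]
  note M2 = order_column_group_ge_2[OF assms(3,2) \<open>x \<noteq> y\<close>]
  define M where "M = order (column_group \<rho> L)"
  define d where "d = (\<Sum>i<M. (L ^ k) ^ i)"
  have Lk: "2 \<le> L ^ k"
    using power_increasing[of 1 k L] L2 \<open>k \<ge> 1\<close> by simp
  have repunit: "(L ^ k - 1) * d = L ^ (k * M) - 1"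
    using repunit_mult_nat[of "L ^ k" M] Lk by (simp add: d_def power_mult)
  have d_div: "(L ^ (k * M) - 1) div (L ^ k - 1) = d"
    using Lk by (subst repunit[symmetric], intro nonzero_mult_div_cancel_left) simp
  obtain M' where M': "M = Suc (Suc M')"
    using M2 unfolding M_def[symmetric] by (metis add_2_eq_Suc le_Suc_ex)
  \<comment> \<open>Splitting off the lowest digit 1 shows both that \<open>d\<close> exceeds 1 and
    that \<open>d\<close> is prime to \<open>L\<close>.\<close>
  have d_eq: "d = 1 + L ^ k * (\<Sum>i<Suc M'. (L ^ k) ^ i)"
    unfolding d_def M' by (subst sum.lessThan_Suc_shift) (simp add: sum_distrib_left del: sum.lessThan_Suc)
  have "1 \<le> (\<Sum>i<Suc M'. (L ^ k) ^ i)"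
    by (subst sum.lessThan_Suc_shift) simp
  then have "d \<ge> 2"
    using Lk by (simp add: d_eq del: sum.lessThan_Suc)
  have "coprime d L"
  proof (rule coprimeI)
    fix c assume c: "c dvd d" "c dvd L"
    then have "c dvd L ^ k * (\<Sum>i<Suc M'. (L ^ k) ^ i)"
      using \<open>k \<ge> 1\<close> by (meson dvd_mult2 dvd_power dvd_trans less_le_trans zero_less_one)
    then show "is_unit c"
      using c(1) unfolding d_eq by (metis dvd_add_left_iff)
  qed
  have "1 * d \<le> (L ^ k - 1) * d"
    using Lk by (intro mult_le_mono1) simp
  then have "d \<le> L ^ (k * M)"
    unfolding repunit by simp
  have "enat (L ^ k) \<le> max_monochromatic v d"
    unfolding max_monochromatic_def
  proof (rule Sup_upper, safe)
    show "\<exists>m. enat (L ^ k) = enat m \<and> (\<exists>j. \<forall>n<m. v !! j = v !! (j + d * n))"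
      using lower_progression[OF assms(3,7)]
      by (intro exI[of _ "L ^ k"] conjI refl exI[of _ 0]) (simp add: d_def M_def mult.commute)
  qed
  moreover have "max_monochromatic v d \<le> enat (L ^ (k * M + N))"
    unfolding max_monochromatic_def
  proof (rule Sup_least, safe)
    fix m j assume j: "\<forall>n<m. v !! j = v !! (j + d * n)"
    show "enat m \<le> enat (L ^ (k * M + N))"
    proof (rule ccontr)
      assume "\<not> ?thesis"
      \<comment> \<open>More than \<open>L ^ (k * M + N)\<close> terms are present, so the index
        equal to this bound is included.\<close>
      then have "v !! j = v !! (j + d * n)" if "n \<le> L ^ (k * M) * L ^ N" for n
        using j that by (simp add: power_add)
      from progression_imp_period[OF assms(3,7) _ \<open>d \<le> L ^ (k * M)\<close> this]
      have "v !! (j div L ^ (k * M) + t) = v !! (j div L ^ (k * M) + t + d)"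
        if "t \<le> d * (L ^ N - 1)" for t
        using that \<open>d \<ge> 2\<close> L_pos by (simp add: Suc_le_eq)
      then show False
        using no_long_period[OF assms(3,5,2,1,4,7,6) L2 \<open>d \<ge> 2\<close> \<open>coprime d L\<close>] by blast
    qed
  qed
  ultimately show ?thesis
    by (simp only: d_div flip: M_def)
qed

end

theorem corollary26:
  fixes \<rho> :: "'a::finite \<Rightarrow> 'a list" and L N k :: nat and v :: "'a stream"
  assumes "substitution \<rho>"
    and "constant_length \<rho> L"
    and "aperiodic_subst \<rho>"
    and "primitive_subst \<rho>"
    and "bijective_subst \<rho> L"
    and "column \<rho> 0 = id"
    and "comm_group (column_group \<rho> L)"
    and "N = legal_pairs_index \<rho>"
    and "fixed_point \<rho> v"
    and "k \<ge> 1"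
  shows "enat (L ^ k) \<le>
      max_monochromatic v ((L ^ (k * order (column_group \<rho> L)) - 1) div (L ^ k - 1)) \<and>
    max_monochromatic v ((L ^ (k * order (column_group \<rho> L)) - 1) div (L ^ k - 1))
      \<le> enat (L ^ (k * order (column_group \<rho> L) + N))"
proof -
  have "0 < L"
    using assms(1,2) by (metis constant_length_def length_greater_0_conv substitution_def)
  then show ?thesis
    by (rule fixed_length_substitution.max_monochromatic_repunit_bounds
        [OF fixed_length_substitution.intro[OF assms(2)] assms(3-10)])
qed

end
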